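(* (1) Let $n = p_1^{k_1}\cdots p_t^{k_t}$ where $t \ge 2$, $p_1 < \cdots < p_t$ are primes, and $k_1,\dots,k_t$ are positive integers. Then: (a) the Apéry set of $S(B_n)$ with respect to $n$ is $$\mathrm{Ap}(S(B_n),n) = \Big\{\sum_{i=1}^{t}\sum_{j=1}^{k_i} c_{i,j}\binom{n}{p_i^{j}} \;\Big|\; c_{i,j}\in\mathbb{Z},\ 0\le c_{i,j}\le p_i-1\Big\};$$ (b) the Frobenius number of $S(B_n)$ is $$F(S(B_n)) = \sum_{i=1}^{t}\sum_{j=1}^{k_i}(p_i-1)\binom{n}{p_i^j} - n.$$ (2) Let $n = p^m$ where $p$ is a prime and $m\ge 1$ is an integer. Then: (a) the Apéry set of $S(B_n)$ with respect to $p^{m-1}$ is $$\mathrm{Ap}(S(B_n),p^{m-1}) = \Big\{\frac1p\sum_{i=1}^{m-1} c_i\binom{n}{p^i} \;\Big|\; c_i\in\mathbb{Z},\ 0\le c_i\le p-1\Big\};$$ (b) the Frobenius number of $S(B_n)$ is $$F(S(B_n)) = \frac{p-1}{p}\sum_{i=1}^{m-1}\binom{p^m}{p^i} - p^{m-1}.$$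
   Context: $\mathbb{N}$ is the set of nonnegative integers. For nonempty $A\subseteq\mathbb{N}$, $\langle A\rangle$ denotes the submonoid of $(\mathbb{N},+)$ generated by $A$ (all finite nonnegative integer combinations of elements of $A$). A numerical semigroup is a submonoid of $\mathbb{N}$ with finite complement. If $n\ge 2$ is not a prime power, $S(B_n) = \left\langle \binom n1,\binom n2,\dots,\binom n{n-1}\right\rangle$. If $n=p^m$ is a prime power ($p$ prime, $m\ge1$), $S(B_n) = \left\langle \frac1p\binom n1,\frac1p\binom n2,\dots,\frac1p\binom n{n-1}\right\rangle$. In both cases $S(B_n)$ is a numerical semigroup. The Frobenius number $F(S)$ of a numerical semigroup $S$ is the greatest integer not belonging to $S$ (so $F(\mathbb{N})=-1$). For $x\in S\setminus\{0\}$, the Apéry set is $\mathrm{Ap}(S,x)=\{s\in S : s-x\notin S\}$. Empty sums equal $0$. *)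

theory Defs
  imports Complex_Main "HOL-Number_Theory.Prime_Powers"
begin

definition submonoid_gen :: "nat set \<Rightarrow> nat set" where
  "submonoid_gen A = {\<Sum>a\<in>B. c a * a | B c. finite B \<and> B \<subseteq> A}"

(* aprimedivisor n is the unique prime divisor p of n if n is a prime power.  In that case
   p divides each of the binomial coefficients below, so that div is exact division.
   Only used for n >= 2. *)
definition binomial_semigroup :: "nat \<Rightarrow> nat set" where
  "binomial_semigroup n =
     (if primepow n
      then submonoid_gen ((\<lambda>k. (n choose k) div aprimedivisor n) ` {1..n - 1})
      else submonoid_gen ((\<lambda>k. n choose k) ` {1..n - 1}))"

(* Membership is tested in the integers: there are integers outside S below 0, so the
   Frobenius number of UNIV is -1, and s - x is not truncated in the Apery set. *)
definition frobenius_number :: "nat set \<Rightarrow> int" where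
  "frobenius_number S = (GREATEST z. z \<notin> int ` S)"

definition apery_set :: "nat set \<Rightarrow> nat \<Rightarrow> nat set" where
  "apery_set S x = {s \<in> S. int s - int x \<notin> int ` S}"

end

theory Submission
  imports Defs "HOL-Number_Theory.Cong"
begin

text \<open>
  Put \<open>N = n\<close>, \<open>d = 1\<close> if \<open>n\<close> is not a prime power and \<open>N = p ^ (m - 1)\<close>, \<open>d = p\<close> if \<open>n = p ^ m\<close>;
  the generators are \<open>b k = (n choose k) / d\<close>, and \<open>b 1 = N\<close>. For a prime power \<open>q = p ^ j\<close> dividing \<open>N\<close>,
  \<open>b q\<close> is \<open>N / q\<close> times a number prime to \<open>p\<close>. Hence the combinations of the \<open>b q\<close> with
  digits \<open>0 \<le> c q < p\<close> represent every residue class modulo \<open>N\<close> exactly once, and the class of a number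
  annihilated by \<open>g\<close> modulo \<open>N\<close> involves only those \<open>q\<close> that divide \<open>g\<close>.

  For \<open>k \<le> n / 2\<close> the maximal combination of the \<open>b q\<close> with \<open>q\<close> a proper divisor of \<open>k\<close> is at most \<open>b k\<close>,
  because binomial coefficients at least double at each step below \<open>n / 4\<close>. Therefore every generator \<open>b k\<close>, and
  every carry \<open>p * b q\<close>, is a combination of smaller \<open>b q\<close> plus a \<^emph>\<open>nonnegative\<close> multiple of
  \<open>N\<close>. So the semigroup consists of the digit combinations plus the multiples of \<open>N\<close>, from which the
  Apery set and the Frobenius number can be read off.
\<close>

section \<open>Inequalities between binomial coefficients\<close>

text \<open>Consecutive coefficients have ratio \<open>(n - k) / (k + 1)\<close>, which the
  hypothesis makes at least 2.\<close>

lemma double_binomial_le_Suc: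
  fixes n k :: nat
  assumes "3 * k + 2 \<le> n"
  shows "2 * (n choose k) \<le> n choose Suc k"
proof -
  have "Suc k * (2 * (n choose k)) = (2 * k + 2) * (n choose k)"
    by simp
  also have "\<dots> \<le> (n - k) * (n choose k)"
    using assms by (intro mult_right_mono) auto
  also have "\<dots> = Suc k * (n choose Suc k)"
    by (simp only: binomial_absorption binomial_absorb_comp)
  finally show ?thesis
    by (simp only: mult_le_cancel1)
qed

text \<open>Doubling makes the bound for \<open>r\<close> at most
  \<open>r * (n choose Suc r)\<close>, which is exactly the next summand, so the new total is at
  most twice that summand. The weight \<open>q - 1\<close> will dominate the largest digit at a
  prime power \<open>q\<close>.\<close>

lemma weighted_binomial_sum_le:
  fixes n r :: nat
  assumes "1 \<le> r" "4 * r \<le> n"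
  shows "(\<Sum>q=1..r. (q - 1) * (n choose q)) \<le> 2 * (r - 1) * (n choose r)"
  using assms
proof (induction r rule: nat_induct_at_least)
  case base
  then show ?case by simp
next
  case (Suc r)
  have "(\<Sum>q=1..Suc r. (q - 1) * (n choose q)) \<le> (r - 1) * (2 * (n choose r)) + r * (n choose Suc r)"
    using Suc by simp
  also have "(r - 1) * (2 * (n choose r)) \<le> r * (n choose Suc r)"
    using Suc by (intro mult_mono double_binomial_le_Suc) auto
  finally show ?case by simp
qed

text \<open>The ratio of consecutive central coefficients, with denominators cleared for use in
  \<open>nat\<close>.\<close>

lemma binomial_2r_r_Suc:
  "Suc r * ((2 * Suc r) choose Suc r) = 2 * (2 * r + 1) * ((2 * r) choose r)"
proof -
  have e: "2 * Suc r = Suc (Suc (2 * r))" "Suc (Suc (2 * r)) - Suc r = Suc r" by auto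
  have "real (Suc r * ((2 * Suc r) choose Suc r)) = real (2 * (2 * r + 1) * ((2 * r) choose r))"
    unfolding e of_nat_mult
    by (simp add: binomial_fact e divide_simps del: binomial_Suc_Suc)
       (simp add: algebra_simps)
  then show ?thesis by (simp only: of_nat_eq_iff)
qed

lemma binomial_3r_r_Suc:
  "2 * Suc r * (2 * r + 1) * ((3 * Suc r) choose Suc r) =
     3 * (3 * r + 2) * (3 * r + 1) * ((3 * r) choose r)"
proof -
  have e: "3 * Suc r = Suc (Suc (Suc (3 * r)))" "Suc (Suc (Suc (3 * r))) - Suc r = Suc (Suc (2 * r))" by auto
  have "real (2 * Suc r * (2 * r + 1) * ((3 * Suc r) choose Suc r)) =
      real (3 * (3 * r + 2) * (3 * r + 1) * ((3 * r) choose r))"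
    unfolding e of_nat_mult
    by (simp add: binomial_fact e divide_simps del: binomial_Suc_Suc)
       (simp add: algebra_simps)
  then show ?thesis by (simp only: of_nat_eq_iff)
qed

text \<open>In each step the coefficient on the left grows by a factor below 4 and the one on the
  right by a factor tending to 27/4, which outweighs the growth of \<open>r - 1\<close>.\<close>

lemma central_binomial_le_3r_choose_r:
  assumes "1 \<le> r"
  shows "2 * (r - 1) * ((2 * r) choose r) \<le> (3 * r) choose r"
proof (cases "r \<le> 3")
  case True
  with assms have "r = 1 \<or> r = 2 \<or> r = 3" by auto
  then show ?thesis
    by (auto simp: binomial_fact numeral_eq_Suc)
next
  case False
  then have "3 \<le> r" by simp
  then show ?thesis
  proof (induction r rule: nat_induct_at_least)
    case base
    then show ?case by (simp add: numeral_eq_Suc)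
  next
    case (Suc r)
    let ?A = "(2 * r) choose r" and ?B = "(3 * r) choose r"
    \<comment> \<open>Writing \<open>r\<close> as \<open>s + 3\<close> removes the truncated
      \<open>r - 1\<close> and leaves a difference of two sides with only positive coefficients in
      \<open>s\<close>. The inequality \<open>poly\<close> fails at \<open>r = 2\<close>, so the
      induction has to start at 3.\<close>
    obtain s where s: "r = s + 3" using Suc.hyps by (metis add.commute le_Suc_ex)
    have poly: "8 * r * (2 * r + 1) * (2 * r + 1) \<le> 2 * (r - 1) * (3 * (3 * r + 2) * (3 * r + 1))"
      unfolding s by (simp add: algebra_simps)
    have "2 * Suc r * (2 * r + 1) * (2 * r * ((2 * Suc r) choose Suc r)) =
        4 * r * (2 * r + 1) * (Suc r * ((2 * Suc r) choose Suc r))"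
      by (simp only: mult_ac)
    also have "\<dots> = 8 * r * (2 * r + 1) * (2 * r + 1) * ?A"
      unfolding binomial_2r_r_Suc by (simp add: algebra_simps)
    also have "\<dots> \<le> 2 * (r - 1) * (3 * (3 * r + 2) * (3 * r + 1)) * ?A"
      using poly by (rule mult_right_mono) simp
    also have "\<dots> = 3 * (3 * r + 2) * (3 * r + 1) * (2 * (r - 1) * ?A)"
      by (simp only: mult_ac)
    also have "\<dots> \<le> 3 * (3 * r + 2) * (3 * r + 1) * ?B"
      using Suc.IH by (rule mult_left_mono) simp
    also have "\<dots> = 2 * Suc r * (2 * r + 1) * ((3 * Suc r) choose Suc r)"
      by (rule binomial_3r_r_Suc [symmetric])
    finally show ?case
      by (simp only: mult_le_cancel1) simp
  qed
qed

text \<open>Choosing two disjoint \<open>r\<close>-sets in turn gives \<open>(n choose r) * ((n - r)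
  choose r) = (n choose (2 * r)) * ((2 * r) choose r)\<close>, and \<open>n - r\<close> is at least
  \<open>3 * r\<close>.\<close>

lemma binomial_le_double_index:
  fixes n r :: nat
  assumes "1 \<le> r" "4 * r \<le> n"
  shows "2 * (r - 1) * (n choose r) \<le> n choose (2 * r)"
proof -
  have "2 * (r - 1) * (n choose r) * ((2 * r) choose r) \<le> (n choose r) * ((3 * r) choose r)"
    using mult_left_mono[OF central_binomial_le_3r_choose_r[OF assms(1)], of "n choose r"]
    by (simp only: mult_ac)
  also have "\<dots> \<le> (n choose r) * ((n - r) choose r)"
    using assms by (intro mult_left_mono binomial_right_mono) auto
  also have "\<dots> = (n choose (2 * r)) * ((2 * r) choose r)"
    using choose_mult[of r "2 * r" n] assms by simp
  finally show ?thesis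
    by simp
qed

text \<open>This is what keeps the multiples of \<open>N\<close> nonnegative later. The prime powers
  in question are proper divisors of \<open>k\<close>, hence at most \<open>k div 2\<close>, so the
  sum may be enlarged to all indices up to there.\<close>

lemma sum_binomial_primepow_factors_le:
  fixes n k g :: nat
  assumes "1 \<le> k" "2 * k \<le> n" "g dvd k" "k \<notin> primepow_factors g"
  shows "(\<Sum>q\<in>primepow_factors g. (aprimedivisor q - 1) * (n choose q)) \<le> n choose k"
proof -
  define r where "r = k div 2"
  have *: "2 \<le> x \<and> x \<le> r" if x: "x \<in> primepow_factors g" for x
  proof -
    have "x dvd k" "x \<noteq> k" "primepow x"
      using x assms by (auto simp: primepow_factors_def)
    then obtain y where y: "k = x * y" by (auto elim: dvdE)
    have "y \<noteq> 0" "y \<noteq> 1" using y assms(1) \<open>x \<noteq> k\<close> by auto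
    then have "x * 2 \<le> k" unfolding y by (intro mult_left_mono) auto
    with primepow_gt_Suc_0[OF \<open>primepow x\<close>] show ?thesis by (auto simp: r_def)
  qed
  show ?thesis
  proof (cases "primepow_factors g = {}")
    case True
    then show ?thesis by simp
  next
    case False
    then have r: "2 \<le> r" using * by fastforce
    have sub: "primepow_factors g \<subseteq> {1..r}" using * by fastforce
    have r4: "4 * r \<le> n" using assms by (auto simp: r_def)
    have "(\<Sum>q\<in>primepow_factors g. (aprimedivisor q - 1) * (n choose q))
        \<le> (\<Sum>q\<in>primepow_factors g. (q - 1) * (n choose q))"
      by (intro sum_mono mult_right_mono diff_le_mono aprimedivisor_le_nat)
         (auto simp: primepow_factors_def intro: primepow_gt_Suc_0)
    also have "\<dots> \<le> (\<Sum>q=1..r. (q - 1) * (n choose q))"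
      using sub by (intro sum_mono2) auto
    also have "\<dots> \<le> 2 * (r - 1) * (n choose r)"
      using r r4 by (intro weighted_binomial_sum_le) auto
    also have "\<dots> \<le> n choose (2 * r)"
      using r r4 by (intro binomial_le_double_index) auto
    \<comment> \<open>\<open>2 * r\<close> is \<open>k\<close> or \<open>k - 1\<close>, and
      coefficients do not decrease up to the middle of the row.\<close>
    also have "\<dots> \<le> n choose k"
      using assms by (intro binomial_mono) (auto simp: r_def)
    finally show ?thesis .
  qed
qed

section \<open>Divisibility of binomial coefficients and prime power divisors\<close>

text \<open>By absorption \<open>n\<close> divides \<open>k * (n choose k)\<close>, and trivially
  \<open>n * (n choose k)\<close>, hence the gcd of the two.\<close>

lemma dvd_gcd_mult_binomial:
  fixes n k :: nat
  assumes "0 < k"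
  shows "n dvd gcd k n * (n choose k)"
proof -
  have "k * (n choose k) = n * ((n - 1) choose (k - 1))"
    using binomial_absorption[of "k - 1" n] assms by simp
  then have "n dvd gcd (k * (n choose k)) (n * (n choose k))"
    by simp
  then show ?thesis
    by (simp add: gcd_mult_distrib_nat mult.commute)
qed

text \<open>For \<open>0 < i < p ^ j\<close> absorption forces \<open>p\<close> to divide
  \<open>n choose i\<close>. By Pascal's rule non-divisibility then passes from each entry of row
  \<open>n - 1\<close> to the next, beginning with 1.\<close>

lemma not_dvd_binomial_pred:
  fixes n p j i :: nat
  assumes "prime p" "p ^ j dvd n" "0 < n" "i < p ^ j"
  shows "\<not> p dvd (n - 1) choose i"
  using \<open>i < p ^ j\<close>
proof (induction i)
  case 0
  then show ?case using assms(1) by (simp add: prime_nat_iff)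
next
  case (Suc i)
  have "p dvd n choose Suc i"
  proof (rule ccontr)
    assume "\<not> p dvd n choose Suc i"
    then have "coprime (p ^ j) (n choose Suc i)"
      using assms(1) by (simp add: prime_imp_coprime)
    moreover have "p ^ j dvd Suc i * (n choose Suc i)"
      unfolding binomial_absorption using assms(2) by simp
    ultimately have "p ^ j dvd Suc i"
      by (simp only: coprime_dvd_mult_left_iff)
    with Suc.prems show False by (auto dest: dvd_imp_le)
  qed
  moreover have "n choose Suc i = ((n - 1) choose i) + ((n - 1) choose Suc i)"
    using assms(3) by (cases n) auto
  ultimately show ?case
    using Suc by (metis Suc_lessD dvd_add_left_iff)
qed

text \<open>As \<open>r\<close> is prime to \<open>p\<close>, lowering the exponent of
  \<open>p\<close> by one removes a single digit position. This matches the step of the induction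
  rule below.\<close>

lemma primepow_factors_prime_mult:
  fixes p j r :: nat
  assumes p: "prime p" and r: "\<not> p dvd r"
  shows "primepow_factors (p ^ Suc j * r) = insert (p ^ Suc j) (primepow_factors (p ^ j * r))"
    and "p ^ Suc j \<notin> primepow_factors (p ^ j * r)"
proof -
  have not_dvd: "\<not> p ^ Suc j dvd p ^ j * r"
    using p r by (simp add: prime_gt_0_nat)
  then show "p ^ Suc j \<notin> primepow_factors (p ^ j * r)"
    by (simp add: primepow_factors_def)
  have "x = p ^ Suc j \<or> x dvd p ^ j * r" if x: "primepow x" "x dvd p ^ Suc j * r" for x
  proof -
    obtain l i where l: "prime l" "i > 0" "x = l ^ i"
      using x(1) by (auto simp: primepow_def)
    show ?thesis
    proof (cases "l = p")
      case True
      have "\<not> Suc j < i"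
      proof
        assume "Suc j < i"
        then have "p ^ Suc (Suc j) dvd p ^ Suc j * r"
          using x(2) l True by (metis Suc_leI dvd_trans le_imp_power_dvd)
        then show False using p r by (simp add: prime_gt_0_nat)
      qed
      then have "i = Suc j \<or> i \<le> j" by auto
      then show ?thesis using l True by (auto intro: dvd_mult2 le_imp_power_dvd)
    next
      case False
      then have "coprime x p" using l p by (simp add: primes_coprime)
      moreover have "x dvd p * (p ^ j * r)" using x(2) by (simp add: mult.assoc)
      ultimately show ?thesis by (simp add: coprime_dvd_mult_right_iff)
    qed
  qed
  then show "primepow_factors (p ^ Suc j * r) = insert (p ^ Suc j) (primepow_factors (p ^ j * r))"
    using p by (auto simp: primepow_factors_def mult.assoc simp flip: power_Suc)
       (auto simp: mult.assoc)
qed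

text \<open>Removes one prime factor at a time while displaying the full power of that prime, so
  that each step treats exactly one digit.\<close>

lemma prime_power_induct [consumes 1, case_names one mult]:
  fixes g :: nat
  assumes "0 < g" and "P 1"
    and step: "\<And>p j r. prime p \<Longrightarrow> \<not> p dvd r \<Longrightarrow> P (p ^ j * r) \<Longrightarrow> P (p ^ Suc j * r)"
  shows "P g"
  using \<open>0 < g\<close>
proof (induction g rule: less_induct)
  case (less g)
  show ?case
  proof (cases "g = 1")
    case True
    then show ?thesis using assms(2) by simp
  next
    case False
    then obtain p where p: "prime p" "p dvd g"
      using prime_factor_nat by blast
    define j where "j = multiplicity p g - 1"
    define r where "r = g div p ^ multiplicity p g"
    have "multiplicity p g > 0"
      using p less.prems by (simp add: prime_multiplicity_gt_zero_iff)
    then have g: "g = p ^ Suc j * r"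
      by (simp add: r_def j_def multiplicity_dvd del: power_Suc)
    have r: "\<not> p dvd r"
      using p less.prems unfolding r_def
      by (metis multiplicity_decompose not_gr_zero not_prime_unit)
    have "p ^ j * r < g"
      using p(1) less.prems g prime_gt_1_nat[OF p(1)] by simp
    then show ?thesis
      using step[OF p(1) r] less g by (metis mult_is_0 not_gr_zero power_Suc)
  qed
qed

section \<open>The semigroup generated by scaled binomial coefficients\<close>

lemma submonoid_gen_zero: "0 \<in> submonoid_gen A"
  unfolding submonoid_gen_def by (rule CollectI, rule exI[of _ "{}"]) simp

lemma submonoid_gen_add:
  assumes "x \<in> submonoid_gen A" "y \<in> submonoid_gen A"
  shows "x + y \<in> submonoid_gen A"
proof -
  obtain B c where x: "x = (\<Sum>a\<in>B. c a * a)" "finite B" "B \<subseteq> A"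
    using assms(1) by (auto simp: submonoid_gen_def)
  obtain D e where y: "y = (\<Sum>a\<in>D. e a * a)" "finite D" "D \<subseteq> A"
    using assms(2) by (auto simp: submonoid_gen_def)
  have "x = (\<Sum>a\<in>B \<union> D. (if a \<in> B then c a else 0) * a)"
    unfolding x(1) using x y by (intro sum.mono_neutral_cong_left) auto
  moreover have "y = (\<Sum>a\<in>B \<union> D. (if a \<in> D then e a else 0) * a)"
    unfolding y(1) using x y by (intro sum.mono_neutral_cong_left) auto
  ultimately have "x + y = (\<Sum>a\<in>B \<union> D. ((if a \<in> B then c a else 0) + (if a \<in> D then e a else 0)) * a)"
    by (simp add: sum.distrib algebra_simps)
  then show ?thesis
    unfolding submonoid_gen_def using x y
    by (intro CollectI exI[of _ "B \<union> D"] exI conjI) auto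
qed

lemma submonoid_gen_mult:
  assumes "a \<in> A"
  shows "c * a \<in> submonoid_gen A"
  unfolding submonoid_gen_def using assms
  by (intro CollectI exI[of _ "{a}"] exI[of _ "\<lambda>_. c"]) auto

lemma submonoid_gen_sum:
  assumes "finite I" "\<And>i. i \<in> I \<Longrightarrow> f i \<in> submonoid_gen A"
  shows "sum f I \<in> submonoid_gen A"
  using assms by (induction I rule: finite_induct) (auto simp: submonoid_gen_zero submonoid_gen_add)

lemma submonoid_gen_minimal:
  assumes "A \<subseteq> V" "0 \<in> V" and add: "\<And>x y. x \<in> V \<Longrightarrow> y \<in> V \<Longrightarrow> x + y \<in> V"
  shows "submonoid_gen A \<subseteq> V"
proof
  fix x assume "x \<in> submonoid_gen A"
  then obtain B c where x: "x = (\<Sum>a\<in>B. c a * a)" "finite B" "B \<subseteq> A"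
    by (auto simp: submonoid_gen_def)
  have mult: "m * a \<in> V" if "a \<in> V" for m a :: nat
    by (induction m) (auto simp: assms(2) add that)
  show "x \<in> V"
    using x(2,3) assms(1) unfolding x(1)
    by (induction B rule: finite_induct) (auto simp: assms(2) intro!: add mult)
qed

lemma primepow_factors_one [simp]: "primepow_factors (1 :: nat) = {}"
  unfolding primepow_factors_def by (auto dest: dvd_imp_le)

text \<open>Common setting for both cases of the theorem. \<open>gcd_dvd\<close> allows gcds with
  \<open>n\<close> to be replaced by gcds with \<open>N\<close>, and \<open>primepow_le\<close> puts
  all digit positions in the lower half of the row, where the inequalities apply.\<close>

locale scaled_binomials =
  fixes n d N :: nat
  assumes n_eq: "n = d * N" and two_le_n: "2 \<le> n"
    and d_dvd: "\<And>k. 0 < k \<Longrightarrow> k < n \<Longrightarrow> d dvd n choose k"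
    and gcd_dvd: "\<And>k. 0 < k \<Longrightarrow> k < n \<Longrightarrow> gcd k n dvd N"
    and primepow_le: "\<And>q. q \<in> primepow_factors N \<Longrightarrow> 2 * q \<le> n"
begin

definition b :: "nat \<Rightarrow> nat" where
  "b k = (n choose k) div d"

abbreviation digits :: "nat \<Rightarrow> (nat \<Rightarrow> nat) \<Rightarrow> bool" where
  "digits g c \<equiv> \<forall>q\<in>primepow_factors g. c q < aprimedivisor q"

abbreviation combination :: "nat \<Rightarrow> (nat \<Rightarrow> nat) \<Rightarrow> nat" where
  "combination g c \<equiv> \<Sum>q\<in>primepow_factors g. c q * b q"

lemma pos: "0 < n" "0 < d" "0 < N"
  using n_eq two_le_n by (auto intro: Nat.gr0I)

lemma d_mult_b: "0 < k \<Longrightarrow> k < n \<Longrightarrow> d * b k = n choose k"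
  unfolding b_def using d_dvd by simp

lemma b_1: "b 1 = N"
  unfolding b_def using n_eq pos by simp

lemma b_symmetric: "k \<le> n \<Longrightarrow> b (n - k) = b k"
  unfolding b_def by (simp add: binomial_symmetric[symmetric])

lemma primepow_factor_bounds:
  assumes "q \<in> primepow_factors N"
  shows "1 < q" "0 < q" "q < n"
  using primepow_le[OF assms] assms primepow_gt_Suc_0[of q] by (auto simp: primepow_factors_def)

lemma finite_primepow_factors_dvd: "g dvd N \<Longrightarrow> finite (primepow_factors g)"
  using pos by (intro finite_primepow_factors) auto

lemma primepow_factors_mono: "g dvd N \<Longrightarrow> primepow_factors g \<subseteq> primepow_factors N"
  by (auto simp: primepow_factors_def)

text \<open>The divisibility for \<open>n choose k\<close> with \<open>d\<close> cancelled; the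
  generator \<open>b k\<close> is thus annihilated modulo \<open>N\<close> by a divisor of
  \<open>N\<close> that also divides \<open>k\<close>.\<close>

lemma dvd_gcd_mult_b:
  assumes "0 < k" "k < n"
  shows "N dvd gcd k N * b k"
proof -
  have "d * N dvd gcd k n * (d * b k)"
    using dvd_gcd_mult_binomial[of k n] assms by (simp only: d_mult_b n_eq [symmetric])
  then have "d * N dvd d * (gcd k n * b k)"
    by (simp only: mult.left_commute)
  then have "N dvd gcd k n * b k"
    using pos by simp
  moreover have "gcd k n dvd gcd k N"
    using gcd_dvd assms by simp
  ultimately show ?thesis
    by (meson dvd_refl dvd_trans mult_dvd_mono)
qed

text \<open>The cofactor \<open>u\<close> is \<open>(n - 1) choose (p ^ Suc j - 1)\<close>, by
  absorption.\<close>

lemma b_prime_power: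
  assumes "prime p" "p ^ Suc j dvd N"
  obtains u where "p ^ Suc j * b (p ^ Suc j) = N * u" "\<not> p dvd u"
proof
  let ?q = "p ^ Suc j"
  have q: "?q \<in> primepow_factors N"
    using assms by (simp add: primepow_factors_def del: power_Suc)
  note bounds = primepow_factor_bounds[OF q]
  have "d * (?q * b ?q) = Suc (?q - 1) * (n choose Suc (?q - 1))"
    using d_mult_b[of ?q] bounds by (simp del: power_Suc add: mult_ac)
  also have "\<dots> = d * (N * ((n - 1) choose (?q - 1)))"
    unfolding binomial_absorption using n_eq by simp
  finally show "?q * b ?q = N * ((n - 1) choose (?q - 1))"
    using pos by simp
  have "?q dvd n"
    using assms(2) n_eq by (metis dvd_mult)
  then show "\<not> p dvd (n - 1) choose (?q - 1)"
    using not_dvd_binomial_pred[OF assms(1), of "Suc j" n "?q - 1"] bounds pos by simp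
qed

section \<open>Existence and uniqueness of digits modulo \<open>N\<close>\<close>

lemma b_prime_power_cofactor:
  assumes "prime p" "p ^ Suc j * r dvd N"
  obtains s u where "N = p ^ Suc j * r * s" "b (p ^ Suc j) = r * s * u" "\<not> p dvd u"
proof -
  obtain u where u: "p ^ Suc j * b (p ^ Suc j) = N * u" "\<not> p dvd u"
    by (rule b_prime_power[OF assms(1) dvd_mult_left[OF assms(2)]])
  obtain s where s: "N = p ^ Suc j * r * s"
    using assms(2) by (auto elim: dvdE)
  have "p ^ Suc j * b (p ^ Suc j) = p ^ Suc j * (r * s * u)"
    unfolding u(1) by (subst s) (simp only: mult_ac)
  then have "b (p ^ Suc j) = r * s * u"
    using assms(1) by (simp add: prime_gt_0_nat)
  with s u(2) show ?thesis
    using that by blast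
qed

text \<open>The digit at the top power \<open>?q\<close> of \<open>p\<close> is chosen so that the
  remainder is annihilated by \<open>?h\<close>, that is, by \<open>g\<close> with one factor
  \<open>p\<close> removed; induction supplies the other digits.\<close>

lemma digits_exist:
  fixes x :: int
  assumes "g dvd N" "int N dvd int g * x"
  shows "\<exists>c. digits g c \<and> int N dvd x - int (combination g c)"
proof -
  have "0 < g" using assms pos by (auto intro: Nat.gr0I)
  then show ?thesis
    using assms
  proof (induction g arbitrary: x rule: prime_power_induct)
    case one
    then show ?case by (simp del: One_nat_def)
  next
    case (mult p j r)
    let ?q = "p ^ Suc j" and ?h = "p ^ j * r"
    obtain s u where s: "N = ?q * r * s" and bq: "b ?q = r * s * u" and u: "\<not> p dvd u"
      by (rule b_prime_power_cofactor[OF mult.hyps(1) mult.prems(1)])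
    have pos': "0 < p" "0 < r" "0 < s"
      using s pos by (auto intro: Nat.gr0I simp: mult.hyps(1) prime_gt_0_nat)
    obtain y where y: "x = int s * y"
    proof -
      have "int (?q * r) * int s dvd int (?q * r) * x"
        using mult.prems(2) unfolding s by simp
      then have "int s dvd x"
        using pos' by (simp del: of_nat_mult of_nat_power)
      then show ?thesis using that by (auto elim: dvdE)
    qed
    have "coprime (int (r * u)) (int p)"
      using mult.hyps u prime_imp_coprime[of p "r * u"]
      by (simp add: prime_dvd_mult_iff coprime_commute del: of_nat_mult)
    then obtain z where z: "[int (r * u) * z = 1] (mod int p)"
      using cong_solve_coprime_int by blast
    \<comment> \<open>With \<open>x = s * y\<close> and \<open>b ?q = r * s * u\<close>, the
      remainder \<open>x - c * b ?q\<close> is annihilated by \<open>?h\<close> modulo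
      \<open>N\<close> as soon as \<open>r * u * c\<close> is congruent to \<open>y\<close> modulo
      \<open>p\<close>; \<open>z\<close> inverts \<open>r * u\<close>.\<close>
    define c where "c = nat ((z * y) mod int p)"
    have c: "int c = (z * y) mod int p"
      using pos' by (simp add: c_def)
    have "[int (r * u) * int c = int (r * u) * (z * y)] (mod int p)"
      unfolding c by (intro cong_mult) auto
    also have "int (r * u) * (z * y) = int (r * u) * z * y" by simp
    also have "[int (r * u) * z * y = 1 * y] (mod int p)"
      using z by (intro cong_mult) auto
    finally have "int p dvd y - int (r * u) * int c"
      by (simp add: cong_iff_dvd_diff dvd_diff_commute)
    then have "int (?h * s) * int p dvd int (?h * s) * (y - int (r * u) * int c)"
      by (rule mult_dvd_mono[OF dvd_refl])
    moreover have "int (?h * s) * int p = int N" unfolding s by (simp add: mult_ac)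
    moreover have "int (?h * s) * (y - int (r * u) * int c) = int ?h * (x - int (c * b ?q))"
      unfolding bq y by (simp add: algebra_simps)
    ultimately have "int N dvd int ?h * (x - int (c * b ?q))" by (simp only:)
    moreover have h: "?h dvd N" using mult.prems(1) by (auto intro: dvd_mult_right simp: mult.assoc)
    ultimately obtain c' where c': "digits ?h c'" "int N dvd x - int (c * b ?q) - int (combination ?h c')"
      using mult.IH by blast
    note ins = primepow_factors_prime_mult[OF mult.hyps(1,2), of j]
    have "c < p"
      using pos' c by (metis of_nat_0_less_iff of_nat_less_iff pos_mod_bound)
    then have "digits (?q * r) (c'(?q := c))"
      unfolding ins(1) using c'(1) ins(2) aprimedivisor_prime_power[OF mult.hyps(1), of "Suc j"]
      by auto
    moreover have "combination ?h (c'(?q := c)) = combination ?h c'"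
      using ins(2) by (intro sum.cong) auto
    then have "combination (?q * r) (c'(?q := c)) = c * b ?q + combination ?h c'"
      unfolding ins(1) using ins(2) finite_primepow_factors_dvd[OF h]
      by (simp del: power_Suc)
    then have "int N dvd x - int (combination (?q * r) (c'(?q := c)))"
      using c'(2) by (simp only: of_nat_add diff_diff_eq)
    ultimately show ?case by blast
  qed
qed

text \<open>Multiplying by \<open>?h\<close> kills every position except the top power of
  \<open>p\<close>, so \<open>p\<close> divides the coefficient there, which is too small to be
  nonzero.\<close>

lemma digit_differences_zero:
  fixes e :: "nat \<Rightarrow> int"
  assumes "g dvd N" "\<And>q. q \<in> primepow_factors g \<Longrightarrow> \<bar>e q\<bar> < int (aprimedivisor q)"
    and "int N dvd (\<Sum>q\<in>primepow_factors g. e q * int (b q))"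
  shows "\<forall>q\<in>primepow_factors g. e q = 0"
proof -
  have "0 < g" using assms pos by (auto intro: Nat.gr0I)
  then show ?thesis
    using assms
  proof (induction g rule: prime_power_induct)
    case one
    then show ?case by (simp del: One_nat_def)
  next
    case (mult p j r)
    let ?q = "p ^ Suc j" and ?h = "p ^ j * r"
    obtain s u where s: "N = ?q * r * s" and bq: "b ?q = r * s * u" and u: "\<not> p dvd u"
      by (rule b_prime_power_cofactor[OF mult.hyps(1) mult.prems(1)])
    have pos': "0 < p" "0 < r" "0 < s"
      using s pos by (auto intro: Nat.gr0I simp: mult.hyps(1) prime_gt_0_nat)
    have h: "?h dvd N" using mult.prems(1) by (auto intro: dvd_mult_right simp: mult.assoc)
    note ins = primepow_factors_prime_mult[OF mult.hyps(1,2), of j]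
    let ?sum = "\<Sum>q\<in>primepow_factors ?h. e q * int (b q)"
    have split: "(\<Sum>q\<in>primepow_factors (?q * r). e q * int (b q)) = e ?q * int (b ?q) + ?sum"
      unfolding ins(1) using ins(2) finite_primepow_factors_dvd[OF h] by (simp del: power_Suc)
    have "int N dvd int ?h * (e q * int (b q))" if "q \<in> primepow_factors ?h" for q
    proof -
      obtain l i where l: "prime l" "q = l ^ Suc i"
        using \<open>q \<in> primepow_factors ?h\<close> by (auto simp: primepow_factors_def primepow_def gr0_conv_Suc)
      have "q dvd ?h" using that by (simp add: primepow_factors_def)
      moreover have "N dvd q * b q"
        using b_prime_power[OF l(1), of i] l(2) dvd_trans[OF \<open>q dvd ?h\<close> h] by (metis dvd_triv_left)
      ultimately have "N dvd ?h * b q" by (meson dvd_refl dvd_trans mult_dvd_mono)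
      then have "int N dvd e q * int (?h * b q)" by (intro dvd_mult) (simp only: of_nat_dvd_iff)
      then show ?thesis by (simp add: mult_ac)
    qed
    then have "int N dvd int ?h * ?sum"
      unfolding sum_distrib_left by (intro dvd_sum)
    moreover have "int N dvd int ?h * (e ?q * int (b ?q) + ?sum)"
      using mult.prems(3) unfolding split by (rule dvd_mult)
    ultimately have "int N dvd int ?h * (e ?q * int (b ?q))"
      by (simp only: distrib_left dvd_add_left_iff)
    moreover have "int N = int (?h * s) * int p" unfolding s by (simp add: mult_ac)
    moreover have "int ?h * (e ?q * int (b ?q)) = int (?h * s) * (int (r * u) * e ?q)"
      unfolding bq by simp
    ultimately have "int p dvd int (r * u) * e ?q"
      using pos' by (simp del: of_nat_mult power_Suc)
    moreover have "coprime (int p) (int (r * u))"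
      using mult.hyps u prime_imp_coprime[of p "r * u"]
      by (simp add: prime_dvd_mult_iff del: of_nat_mult)
    ultimately have "int p dvd e ?q"
      by (simp only: coprime_dvd_mult_right_iff)
    moreover have "\<bar>e ?q\<bar> < int p"
      using mult.prems(2)[of ?q] ins(1) aprimedivisor_prime_power[OF mult.hyps(1), of "Suc j"] by simp
    ultimately have eq: "e ?q = 0"
      by (metis abs_of_nat dvd_imp_le_int not_less)
    have "\<forall>q\<in>primepow_factors ?h. e q = 0"
    proof (rule mult.IH[OF h])
      show "\<bar>e q\<bar> < int (aprimedivisor q)" if "q \<in> primepow_factors ?h" for q
        using that by (intro mult.prems(2)) (simp only: ins(1) insert_iff simp_thms)
      show "int N dvd ?sum"
        using mult.prems(3) unfolding split eq by simp
    qed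
    then show ?case
      unfolding ins(1) using eq by blast
  qed
qed

lemma digits_unique:
  assumes "digits N c" "digits N c'" "combination N c = combination N c' + a * N"
  shows "a = 0"
proof -
  have "int (combination N c) - int (combination N c') = int a * int N"
    unfolding assms(3) by simp
  then have "int N dvd (\<Sum>q\<in>primepow_factors N. (int (c q) - int (c' q)) * int (b q))"
    by (simp add: sum_subtractf left_diff_distrib)
  moreover have "\<bar>int (c q) - int (c' q)\<bar> < int (aprimedivisor q)" if "q \<in> primepow_factors N" for q
    using assms(1,2) that by fastforce
  ultimately have "\<forall>q\<in>primepow_factors N. int (c q) - int (c' q) = 0"
    by (intro digit_differences_zero) auto
  then have "combination N c = combination N c'"
    by (intro sum.cong) auto
  then show ?thesis
    using assms(3) pos by simp
qed

section \<open>Generators and carries as combinations plus nonnegative multiples of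
  \<open>N\<close>\<close>

lemma combination_le:
  assumes "digits g c"
  shows "combination g c \<le> combination g (\<lambda>q. aprimedivisor q - 1)"
  using assms by (intro sum_mono mult_right_mono) fastforce+

text \<open>Digits for the residue class of \<open>x\<close> can be taken at divisors of
  \<open>g\<close> only. Even the maximal such combination is at most \<open>b k\<close>, hence at
  most \<open>x\<close>, so the difference is a nonnegative multiple of \<open>N\<close>.\<close>

lemma representable:
  assumes "0 < k" "2 * k \<le> n" "g dvd k" "g dvd N" "k \<notin> primepow_factors g"
    and "b k \<le> x" "N dvd g * x"
  obtains c a where "x = combination g c + a * N"
proof -
  have "int N dvd int g * int x"
    using assms(7) by (simp flip: of_nat_mult)
  then obtain c where c: "digits g c" "int N dvd int x - int (combination g c)"
    using digits_exist[OF assms(4)] by blast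
  \<comment> \<open>Scaling by \<open>d\<close> turns each \<open>b q\<close> back into a binomial
    coefficient, for which the inequality is known.\<close>
  have "d * combination g (\<lambda>q. aprimedivisor q - 1)
      = (\<Sum>q\<in>primepow_factors g. (aprimedivisor q - 1) * (n choose q))"
    unfolding sum_distrib_left
  proof (intro sum.cong refl)
    fix q assume "q \<in> primepow_factors g"
    then have "q \<in> primepow_factors N" using primepow_factors_mono[OF assms(4)] by blast
    then show "d * ((aprimedivisor q - 1) * b q) = (aprimedivisor q - 1) * (n choose q)"
      using d_mult_b[of q] primepow_factor_bounds[of q] by simp
  qed
  also have "\<dots> \<le> d * b k"
    using sum_binomial_primepow_factors_le[of k n g] d_mult_b[of k] assms by simp
  finally have "combination g (\<lambda>q. aprimedivisor q - 1) \<le> b k"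
    using pos by simp
  then have le: "combination g c \<le> x"
    using combination_le[OF c(1)] assms(6) by linarith
  then have "N dvd x - combination g c"
    using c(2) by (metis of_nat_diff of_nat_dvd_iff)
  then obtain a where "x - combination g c = a * N"
    by (metis dvdE mult.commute)
  then show ?thesis
    using that[of c a] le by simp
qed

lemma combination_extend:
  assumes "g dvd h" "h dvd N"
  shows "combination g c = combination h (\<lambda>q. if q \<in> primepow_factors g then c q else 0)"
  using assms finite_primepow_factors_dvd[OF assms(2)]
  by (intro sum.mono_neutral_cong_left) (auto simp: primepow_factors_def)

text \<open>Apply \<open>representable\<close> with \<open>k = p ^ Suc j\<close> and
  \<open>g = p ^ j\<close>, as \<open>p ^ j\<close> annihilates \<open>p * b (p ^ Suc j)\<close>
  modulo \<open>N\<close>. Carries thus reach only lower powers of the same prime.\<close>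

lemma carry:
  assumes "prime p" "p ^ Suc j dvd N"
  obtains c a where "p * b (p ^ Suc j) = combination (p ^ j) c + a * N"
proof -
  let ?q = "p ^ Suc j"
  have q: "?q \<in> primepow_factors N"
    using assms by (simp add: primepow_factors_def del: power_Suc)
  obtain u where u: "?q * b ?q = N * u"
    using b_prime_power[OF assms] by blast
  have "?q \<notin> primepow_factors (p ^ j)"
    using assms(1) by (auto simp: primepow_factors_def prime_gt_0_nat prime_nat_iff dest!: dvd_imp_le)
  moreover have "N dvd p ^ j * (p * b ?q)"
    using u by (metis dvd_triv_left mult.assoc power_Suc2)
  moreover have "p ^ j dvd N"
    using assms(2) by (auto intro: dvd_trans)
  moreover have "b ?q \<le> p * b ?q"
    using prime_gt_0_nat[OF assms(1)] by (cases p) simp_all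
  ultimately show ?thesis
    using that primepow_le[OF q] primepow_factor_bounds[OF q]
    by (rule_tac representable[of ?q "p ^ j" "p * b ?q"]) auto
qed

text \<open>The top power of \<open>p\<close> is normalised first. Its carries land at positions
  dividing \<open>?h\<close>, where the induction hypothesis holds for arbitrary
  coefficients.\<close>

lemma reduce:
  assumes "g dvd N"
  shows "\<exists>c' a. digits g c' \<and> combination g c = combination g c' + a * N"
proof -
  have "0 < g" using assms pos by (auto intro: Nat.gr0I)
  then show ?thesis
    using assms
  proof (induction g arbitrary: c rule: prime_power_induct)
    case one
    then show ?case by (simp del: One_nat_def)
  next
    case (mult p j r)
    let ?q = "p ^ Suc j" and ?h = "p ^ j * r"
    note ins = primepow_factors_prime_mult[OF mult.hyps(1,2), of j]
    have h: "?h dvd N" using mult.prems(1) by (auto intro: dvd_mult_right simp: mult.assoc)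
    have split: "combination (?q * r) f = f ?q * b ?q + combination ?h f" for f
      unfolding ins(1) using ins(2) finite_primepow_factors_dvd[OF h] by (simp del: power_Suc)
    obtain e a where ea: "p * b ?q = combination (p ^ j) e + a * N"
      by (rule carry[OF mult.hyps(1) dvd_mult_left[OF mult.prems(1)]])
    define e' where "e' = (\<lambda>q. if q \<in> primepow_factors (p ^ j) then e q else 0)"
    have e': "p * b ?q = combination ?h e' + a * N"
      unfolding ea e'_def using combination_extend[OF _ h, of "p ^ j" e] by simp
    \<comment> \<open>The number of carries out of position \<open>?q\<close>.\<close>
    define k where "k = c ?q div p"
    obtain c' a' where c': "digits ?h c'"
        "combination ?h (\<lambda>q. c q + k * e' q) = combination ?h c' + a' * N"
      using mult.IH[OF h, of "\<lambda>q. c q + k * e' q"] by (elim exE conjE) (rule that; assumption)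
    have "c ?q * b ?q = (c ?q mod p + k * p) * b ?q"
      unfolding k_def by (simp only: mod_div_mult_eq)
    then have "combination (?q * r) c = (c ?q mod p) * b ?q + k * (p * b ?q) + combination ?h c"
      unfolding split by (simp only: add_mult_distrib mult.assoc)
    also have "\<dots> = (c ?q mod p) * b ?q + combination ?h (\<lambda>q. c q + k * e' q) + k * a * N"
      unfolding e' by (simp add: algebra_simps sum.distrib sum_distrib_left)
    also have "\<dots> = (c ?q mod p) * b ?q + combination ?h c' + (a' + k * a) * N"
      unfolding c'(2) by (simp add: algebra_simps)
    also have "combination ?h c' = combination ?h (c'(?q := c ?q mod p))"
      using ins(2) by (intro sum.cong) auto
    also have "(c ?q mod p) * b ?q + \<dots> = combination (?q * r) (c'(?q := c ?q mod p))"
      unfolding split by simp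
    finally have "combination (?q * r) c = combination (?q * r) (c'(?q := c ?q mod p)) + (a' + k * a) * N" .
    moreover have "digits (?q * r) (c'(?q := c ?q mod p))"
      unfolding ins(1) using c'(1) ins(2) aprimedivisor_prime_power[OF mult.hyps(1), of "Suc j"]
      by (auto simp: mult.hyps(1) prime_gt_0_nat)
    ultimately show ?case by blast
  qed
qed

text \<open>In the lower half, \<open>k\<close> is either itself a digit position or is handled by
  \<open>representable\<close> with \<open>g = gcd k N\<close>; symmetry gives the upper
  half.\<close>

lemma b_representable:
  assumes "0 < k" "k < n"
  shows "\<exists>c a. b k = combination N c + a * N"
proof -
  have *: "\<exists>c a. b k = combination N c + a * N" if k: "0 < k" "2 * k \<le> n" for k
  proof (cases "k \<in> primepow_factors N")
    case True
    have "combination N (\<lambda>q. if q = k then 1 else 0) = (\<Sum>q\<in>primepow_factors N. if q = k then b k else 0)"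
      by (intro sum.cong) auto
    also have "\<dots> = b k"
      using True finite_primepow_factors_dvd[of N] by simp
    finally show ?thesis
      by (intro exI[of _ "\<lambda>q. if q = k then 1 else 0"] exI[of _ 0]) simp
  next
    case False
    have "k < n" using k two_le_n by linarith
    then have "N dvd gcd k N * b k" using dvd_gcd_mult_b k by blast
    moreover have "k \<notin> primepow_factors (gcd k N)" using False by (auto simp: primepow_factors_def)
    ultimately obtain c a where "b k = combination (gcd k N) c + a * N"
      using representable[OF k, of "gcd k N" "b k"] by auto
    then show ?thesis
      using combination_extend[of "gcd k N" N c] by auto
  qed
  show ?thesis
  proof (cases "2 * k \<le> n")
    case True
    then show ?thesis using * assms by blast
  next
    case False
    then show ?thesis using *[of "n - k"] assms b_symmetric[of k] by auto
  qed
qed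

section \<open>The semigroup, its Apery set and its Frobenius number\<close>

definition S :: "nat set" where
  "S = submonoid_gen (b ` {1..n - 1})"

lemma S_eq: "S = {combination N c + a * N | c a. digits N c}"
proof
  \<comment> \<open>Without digit bounds the set is evidently closed under addition;
    \<open>reduce\<close> restores the bounds afterwards.\<close>
  let ?V = "{combination N c + a * N | c a. True}"
  have "S \<subseteq> ?V"
    unfolding S_def
  proof (rule submonoid_gen_minimal)
    show "b ` {1..n - 1} \<subseteq> ?V"
      using b_representable by fastforce
    show "0 \<in> ?V"
      by (intro CollectI exI[of _ "\<lambda>_. 0"] exI[of _ 0]) simp
    fix x y assume "x \<in> ?V" "y \<in> ?V"
    then obtain c a c' a' where "x = combination N c + a * N" "y = combination N c' + a' * N"
      by blast
    then have "x + y = combination N (\<lambda>q. c q + c' q) + (a + a') * N"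
      by (simp add: algebra_simps sum.distrib)
    then show "x + y \<in> ?V" by (intro CollectI exI conjI TrueI)
  qed
  also have "?V \<subseteq> {combination N c + a * N | c a. digits N c}"
  proof
    fix x assume "x \<in> ?V"
    then obtain c a where x: "x = combination N c + a * N" by blast
    obtain c' a' where c': "digits N c'" "combination N c = combination N c' + a' * N"
      using reduce[OF dvd_refl, of c] by (elim exE conjE) (rule that; assumption)
    have "x = combination N c' + (a' + a) * N"
      using x c'(2) by (simp add: algebra_simps)
    with c'(1) show "x \<in> {combination N c + a * N | c a. digits N c}" by blast
  qed
  finally show "S \<subseteq> {combination N c + a * N | c a. digits N c}" .
  have "combination N c + a * N \<in> S" for c a
    unfolding S_def
  proof (intro submonoid_gen_add submonoid_gen_sum submonoid_gen_mult)
    show "finite (primepow_factors N)" by (rule finite_primepow_factors_dvd) simp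
    show "N \<in> b ` {1..n - 1}"
      using b_1 two_le_n by (intro image_eqI[of _ _ 1]) auto
    show "b q \<in> b ` {1..n - 1}" if "q \<in> primepow_factors N" for q
      using primepow_factor_bounds[OF that] by (intro imageI) auto
  qed
  then show "{combination N c + a * N | c a. digits N c} \<subseteq> S" by blast
qed

text \<open>Membership would give two digit representations differing by a positive multiple of
  \<open>N\<close>.\<close>

lemma combination_minus_notin_S:
  assumes "digits N c"
  shows "int (combination N c) - int N \<notin> int ` S"
proof
  assume "int (combination N c) - int N \<in> int ` S"
  then obtain c' a where c': "digits N c'"
      "int (combination N c) - int N = int (combination N c' + a * N)"
    unfolding S_eq by blast
  then have "int (combination N c) = int (combination N c' + Suc a * N)"
    by simp
  then have "combination N c = combination N c' + Suc a * N"
    by (simp only: of_nat_eq_iff)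
  then show False
    using digits_unique[OF assms c'(1)] by blast
qed

lemma apery_set_S: "apery_set S N = {combination N c | c. digits N c}"
proof
  show "{combination N c | c. digits N c} \<subseteq> apery_set S N"
  proof
    fix x assume "x \<in> {combination N c | c. digits N c}"
    then obtain c where c: "digits N c" "x = combination N c" by blast
    then have "x \<in> S"
      unfolding S_eq by (intro CollectI exI[of _ c] exI[of _ 0]) simp
    then show "x \<in> apery_set S N"
      unfolding apery_set_def using c combination_minus_notin_S by blast
  qed
  show "apery_set S N \<subseteq> {combination N c | c. digits N c}"
  proof
    fix x assume x: "x \<in> apery_set S N"
    then obtain c a where c: "digits N c" "x = combination N c + a * N"
      unfolding apery_set_def S_eq by blast
    have "a = 0"
    proof (rule ccontr)
      assume "a \<noteq> 0"
      then obtain a' where "a = Suc a'" by (cases a) auto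
      then have "int x - int N = int (combination N c + a' * N)"
        using c(2) by simp
      moreover have "combination N c + a' * N \<in> S" unfolding S_eq using c(1) by blast
      ultimately show False using x unfolding apery_set_def by blast
    qed
    with c show "x \<in> {combination N c | c. digits N c}" by auto
  qed
qed

text \<open>An integer outside \<open>S\<close> is a digit combination plus a negative multiple of
  \<open>N\<close>; it is largest when all digits are maximal and \<open>N\<close> is subtracted
  once.\<close>

lemma frobenius_number_S:
  "frobenius_number S = int (combination N (\<lambda>q. aprimedivisor q - 1)) - int N"
  unfolding frobenius_number_def
proof (rule Greatest_equality)
  show "int (combination N (\<lambda>q. aprimedivisor q - 1)) - int N \<notin> int ` S"
    by (intro combination_minus_notin_S) (auto simp: primepow_factors_def dest: primepow_gt_Suc_0)
next
  fix z assume z: "z \<notin> int ` S"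
  obtain c where c: "digits N c" "int N dvd z - int (combination N c)"
    using digits_exist[of N z] by auto
  then obtain a where a: "z - int (combination N c) = int N * a"
    by (auto elim: dvdE)
  have "a < 0"
  proof (rule ccontr)
    assume "\<not> a < 0"
    then have "z = int (combination N c + nat a * N)"
      using a by (simp add: algebra_simps)
    then show False using z c(1) unfolding S_eq by blast
  qed
  then have "int N * a \<le> int N * (- 1)"
    by (intro mult_left_mono) auto
  moreover have "int (combination N c) \<le> int (combination N (\<lambda>q. aprimedivisor q - 1))"
    using combination_le[OF c(1)] by (simp only: of_nat_le_iff)
  ultimately show "z \<le> int (combination N (\<lambda>q. aprimedivisor q - 1)) - int N"
    using a by linarith
qed

end

section \<open>Reindexing digits by an arbitrary parametrisation of the prime powers\<close>

context scaled_binomials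
begin

lemma apery_set_S_reindex:
  assumes h: "bij_betw h I (primepow_factors N)"
  shows "int ` apery_set S N =
    {\<Sum>x\<in>I. f x * int (b (h x)) | f. \<forall>x\<in>I. 0 \<le> f x \<and> f x \<le> int (aprimedivisor (h x)) - 1}"
    (is "_ = ?R")
proof
  have comb: "combination N c = (\<Sum>x\<in>I. c (h x) * b (h x))" for c
    using sum.reindex_bij_betw[OF h, of "\<lambda>q. c q * b q"] by simp
  have hI: "h x \<in> primepow_factors N" if "x \<in> I" for x
    using that h by (rule_tac bij_betwE[THEN bspec])
  show "int ` apery_set S N \<subseteq> ?R"
  proof
    fix y assume "y \<in> int ` apery_set S N"
    then obtain c where c: "digits N c" "y = int (combination N c)"
      unfolding apery_set_S by blast
    have "y = (\<Sum>x\<in>I. int (c (h x)) * int (b (h x)))"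
      unfolding c(2) comb by simp
    moreover have "\<forall>x\<in>I. 0 \<le> int (c (h x)) \<and> int (c (h x)) \<le> int (aprimedivisor (h x)) - 1"
      using c(1) hI by fastforce
    ultimately show "y \<in> ?R"
      by (intro CollectI exI[of _ "\<lambda>x. int (c (h x))"] conjI)
  qed
  show "?R \<subseteq> int ` apery_set S N"
  proof
    fix y assume "y \<in> ?R"
    then obtain f where f: "y = (\<Sum>x\<in>I. f x * int (b (h x)))"
        "\<forall>x\<in>I. 0 \<le> f x \<and> f x \<le> int (aprimedivisor (h x)) - 1"
      by blast
    define c where "c q = nat (f (inv_into I h q))" for q
    have inv: "inv_into I h (h x) = x" if "x \<in> I" for x
      using that h by (simp add: bij_betw_inv_into_left)
    have "digits N c"
    proof
      fix q assume "q \<in> primepow_factors N"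
      then obtain x where x: "x \<in> I" "q = h x"
        using h by (auto simp: bij_betw_def)
      then have "0 \<le> f x" "f x \<le> int (aprimedivisor q) - 1"
        using f(2) by auto
      then show "c q < aprimedivisor q"
        using x inv by (simp add: c_def)
    qed
    moreover have "y = int (combination N c)"
      unfolding f(1) comb of_nat_sum using inv f(2) by (intro sum.cong) (auto simp: c_def)
    ultimately show "y \<in> int ` apery_set S N"
      unfolding apery_set_S by blast
  qed
qed

lemma frobenius_number_S_reindex:
  assumes h: "bij_betw h I (primepow_factors N)"
  shows "frobenius_number S = (\<Sum>x\<in>I. (int (aprimedivisor (h x)) - 1) * int (b (h x))) - int N"
proof -
  have "combination N (\<lambda>q. aprimedivisor q - 1) = (\<Sum>x\<in>I. (aprimedivisor (h x) - 1) * b (h x))"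
    using sum.reindex_bij_betw[OF h, of "\<lambda>q. (aprimedivisor q - 1) * b q"] by simp
  also have "int \<dots> = (\<Sum>x\<in>I. (int (aprimedivisor (h x)) - 1) * int (b (h x)))"
    unfolding of_nat_sum
  proof (intro sum.cong refl)
    fix x assume "x \<in> I"
    then have "h x \<in> primepow_factors N"
      using h by (rule_tac bij_betwE[THEN bspec])
    then have "0 < aprimedivisor (h x)"
      by (auto simp: primepow_factors_def dest: primepow_gt_Suc_0)
    then show "int ((aprimedivisor (h x) - 1) * b (h x)) = (int (aprimedivisor (h x)) - 1) * int (b (h x))"
      by (simp add: of_nat_diff)
  qed
  finally show ?thesis
    unfolding frobenius_number_S by simp
qed

end

section \<open>Prime power divisors by exponents, and the two cases of the theorem\<close>

lemma bij_betw_primepow_factors_prod: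
  fixes p k :: "nat \<Rightarrow> nat"
  assumes "finite I" and p: "\<And>i. i \<in> I \<Longrightarrow> prime (p i)" and inj: "inj_on p I"
  shows "bij_betw (\<lambda>(i, j). p i ^ j) (SIGMA i:I. {1..k i}) (primepow_factors (\<Prod>i\<in>I. p i ^ k i))"
  unfolding bij_betw_def
proof
  show "inj_on (\<lambda>(i, j). p i ^ j) (SIGMA i:I. {1..k i})"
  proof (rule inj_onI, clarify)
    fix i j i' j'
    assume ij: "i \<in> I" "i' \<in> I" "j \<in> {1..k i}" "j' \<in> {1..k i'}" and eq: "p i ^ j = p i' ^ j'"
    have "p i = aprimedivisor (p i ^ j)" "p i' = aprimedivisor (p i' ^ j')"
      using ij p by (simp_all add: aprimedivisor_prime_power)
    then have "p i = p i'" using eq by simp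
    moreover have "1 < p i" using p ij prime_gt_1_nat by blast
    ultimately have "j = j'" using eq by (simp add: power_inject_exp)
    then show "i = i' \<and> j = j'" using inj ij \<open>p i = p i'\<close> by (auto dest: inj_onD)
  qed
  show "(\<lambda>(i, j). p i ^ j) ` (SIGMA i:I. {1..k i}) = primepow_factors (\<Prod>i\<in>I. p i ^ k i)"
  proof (intro equalityI subsetI)
    fix q assume "q \<in> (\<lambda>(i, j). p i ^ j) ` (SIGMA i:I. {1..k i})"
    then obtain i j where ij: "i \<in> I" "1 \<le> j" "j \<le> k i" "q = p i ^ j" by auto
    have "p i ^ j dvd p i ^ k i" using ij by (simp add: le_imp_power_dvd)
    also have "\<dots> dvd (\<Prod>i\<in>I. p i ^ k i)" using assms(1) ij by (intro dvd_prodI)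
    finally show "q \<in> primepow_factors (\<Prod>i\<in>I. p i ^ k i)"
      using ij p by (simp add: primepow_factors_def)
  next
    fix q assume "q \<in> primepow_factors (\<Prod>i\<in>I. p i ^ k i)"
    then obtain l e where l: "prime l" "0 < e" "q = l ^ e" "l ^ e dvd (\<Prod>i\<in>I. p i ^ k i)"
      by (auto simp: primepow_factors_def primepow_def)
    have "l dvd (\<Prod>i\<in>I. p i ^ k i)"
      using l by (meson dvd_power dvd_trans)
    then obtain i where i: "i \<in> I" "l dvd p i ^ k i"
      using l(1) assms(1) by (auto simp: prime_dvd_prod_iff)
    then have "l = p i"
      using l(1) p by (meson prime_dvd_power primes_dvd_imp_eq)
    have "coprime (l ^ e) (\<Prod>i'\<in>I - {i}. p i' ^ k i')"
    proof (intro prod_coprime_right)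
      fix i' assume i': "i' \<in> I - {i}"
      then have "p i \<noteq> p i'" using inj i by (auto dest: inj_onD)
      then show "coprime (l ^ e) (p i' ^ k i')"
        using i' i p \<open>l = p i\<close> by (auto intro: primes_coprime)
    qed
    then have "l ^ e dvd p i ^ k i"
      using l(4) i(1) assms(1) by (simp add: prod.remove[of I i] coprime_dvd_mult_left_iff)
    then have "e \<le> k i"
      unfolding \<open>l = p i\<close> [symmetric] using prime_gt_1_nat[OF l(1)] by (rule power_dvd_imp_le)
    then show "q \<in> (\<lambda>(i, j). p i ^ j) ` (SIGMA i:I. {1..k i})"
      using l i \<open>l = p i\<close> by (intro image_eqI[of _ _ "(i, e)"]) auto
  qed
qed

lemma bij_betw_primepow_factors_power:
  fixes p :: nat
  assumes "prime p"
  shows "bij_betw (\<lambda>i. p ^ i) {1..m} (primepow_factors (p ^ m))"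
  unfolding bij_betw_def
proof
  show "inj_on ((^) p) {1..m}"
    using prime_gt_1_nat[OF assms] by (auto intro!: inj_onI)
  show "(^) p ` {1..m} = primepow_factors (p ^ m)"
  proof (intro equalityI subsetI)
    fix q assume "q \<in> primepow_factors (p ^ m)"
    then obtain i where "i \<le> m" "q = p ^ i" "primepow q"
      using assms by (auto simp: primepow_factors_def divides_primepow_nat)
    then show "q \<in> (^) p ` {1..m}"
      using assms by (intro image_eqI[of _ _ i]) (auto simp: Suc_le_eq)
  qed (use assms in \<open>auto simp: primepow_factors_def le_imp_power_dvd\<close>)
qed

lemma binomial_semigroup_not_primepow:
  fixes p k :: "nat \<Rightarrow> nat" and t n :: nat
  assumes t: "2 \<le> t" and p: "\<forall>i\<in>{1..t}. prime (p i)" and mono: "strict_mono_on {1..t} p"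
    and k: "\<forall>i\<in>{1..t}. 1 \<le> k i" and n: "n = (\<Prod>i=1..t. p i ^ k i)"
  shows "int ` apery_set (binomial_semigroup n) n =
          {\<Sum>i=1..t. \<Sum>j=1..k i. c i j * int (n choose (p i ^ j)) | c :: nat \<Rightarrow> nat \<Rightarrow> int.
             \<forall>i\<in>{1..t}. \<forall>j\<in>{1..k i}. 0 \<le> c i j \<and> c i j \<le> int (p i) - 1}" (is ?apery)
    and "frobenius_number (binomial_semigroup n) =
          (\<Sum>i=1..t. \<Sum>j=1..k i. (int (p i) - 1) * int (n choose (p i ^ j))) - int n" (is ?frobenius)
proof -
  have inj: "inj_on p {1..t}"
    using mono by (rule strict_mono_on_imp_inj_on)
  have "0 < n"
    unfolding n using p by (auto intro!: prod_pos simp: prime_gt_0_nat)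
  have dvd: "p i dvd n" if "i \<in> {1..t}" for i
  proof -
    have "p i dvd p i ^ k i" using bspec[OF k that] by (intro dvd_power) auto
    also have "\<dots> dvd n" unfolding n using that by (intro dvd_prodI) auto
    finally show ?thesis .
  qed
  have "p 1 \<noteq> p 2"
    using inj t by (auto dest: inj_onD)
  then have npp: "\<not> primepow n"
    using not_primepowI[of "p 1" "p 2" n] p t dvd[of 1] dvd[of 2] by auto
  have "2 \<le> n"
    using dvd[of 1] t p \<open>0 < n\<close> prime_ge_2_nat[of "p 1"] by (auto dest!: dvd_imp_le)
  \<comment> \<open>Since \<open>n\<close> is not a prime power, its prime power divisors are proper
    and so at most \<open>n / 2\<close>.\<close>
  interpret scaled_binomials n 1 n
  proof
    fix q assume q: "q \<in> primepow_factors n"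
    then obtain y where y: "n = q * y" by (auto simp: primepow_factors_def elim: dvdE)
    have "y \<noteq> 1" "y \<noteq> 0" using q y npp \<open>0 < n\<close> by (auto simp: primepow_factors_def)
    then have "q * 2 \<le> n" unfolding y by (intro mult_left_mono) auto
    then show "2 * q \<le> n" by simp
  qed (use \<open>2 \<le> n\<close> in auto)
  have b: "b = (\<lambda>k. n choose k)"
    by (rule ext) (simp only: b_def div_by_1)
  have S: "binomial_semigroup n = S"
    unfolding binomial_semigroup_def S_def b using npp by simp
  let ?I = "SIGMA i:{1..t}. {1..k i}"
  have bij: "bij_betw (\<lambda>(i, j). p i ^ j) ?I (primepow_factors n)"
    unfolding n using bij_betw_primepow_factors_prod[OF _ _ inj, of k] p by simp
  have ap: "aprimedivisor (p i ^ j) = p i" if "(i, j) \<in> ?I" for i j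
    using that p by (simp add: aprimedivisor_prime_power)
  have sum: "(\<Sum>x\<in>?I. f x * int (b (case x of (i, j) \<Rightarrow> p i ^ j))) =
      (\<Sum>i=1..t. \<Sum>j=1..k i. f (i, j) * int (n choose (p i ^ j)))" for f :: "nat \<times> nat \<Rightarrow> int"
    unfolding b by (simp add: sum.Sigma case_prod_unfold)
  show ?apery
    unfolding S apery_set_S_reindex[OF bij] sum
  proof (intro equalityI subsetI)
    fix x assume "x \<in> {\<Sum>i=1..t. \<Sum>j=1..k i. f (i, j) * int (n choose (p i ^ j)) | f.
        \<forall>x\<in>?I. 0 \<le> f x \<and> f x \<le> int (aprimedivisor (case x of (i, j) \<Rightarrow> p i ^ j)) - 1}"
    then obtain f where "x = (\<Sum>i=1..t. \<Sum>j=1..k i. f (i, j) * int (n choose (p i ^ j)))"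
        "\<forall>i\<in>{1..t}. \<forall>j\<in>{1..k i}. 0 \<le> f (i, j) \<and> f (i, j) \<le> int (p i) - 1"
      using ap by auto
    then show "x \<in> {\<Sum>i=1..t. \<Sum>j=1..k i. c i j * int (n choose (p i ^ j)) | c.
             \<forall>i\<in>{1..t}. \<forall>j\<in>{1..k i}. 0 \<le> c i j \<and> c i j \<le> int (p i) - 1}"
      by (intro CollectI exI[of _ "\<lambda>i j. f (i, j)"] conjI)
  next
    fix x assume "x \<in> {\<Sum>i=1..t. \<Sum>j=1..k i. c i j * int (n choose (p i ^ j)) | c.
             \<forall>i\<in>{1..t}. \<forall>j\<in>{1..k i}. 0 \<le> c i j \<and> c i j \<le> int (p i) - 1}"
    then obtain c where "x = (\<Sum>i=1..t. \<Sum>j=1..k i. c i j * int (n choose (p i ^ j)))"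
        "\<forall>i\<in>{1..t}. \<forall>j\<in>{1..k i}. 0 \<le> c i j \<and> c i j \<le> int (p i) - 1"
      by blast
    then show "x \<in> {\<Sum>i=1..t. \<Sum>j=1..k i. f (i, j) * int (n choose (p i ^ j)) | f.
        \<forall>x\<in>?I. 0 \<le> f x \<and> f x \<le> int (aprimedivisor (case x of (i, j) \<Rightarrow> p i ^ j)) - 1}"
      using ap by (intro CollectI exI[of _ "\<lambda>(i, j). c i j"] conjI) auto
  qed
  show ?frobenius
    unfolding S frobenius_number_S_reindex[OF bij] sum
    using ap by simp
qed

text \<open>Stated in the reals because of the factor \<open>1 / p\<close>. For \<open>m = 1\<close>
  there are no digit positions and \<open>N = 1\<close>, which gives the Frobenius number
  -1.\<close>

lemma binomial_semigroup_prime_power: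
  fixes p m :: nat
  assumes p: "prime p" and m: "1 \<le> m"
  shows "real ` apery_set (binomial_semigroup (p ^ m)) (p ^ (m - 1)) =
          {1 / real p * (\<Sum>i=1..m - 1. real_of_int (c i) * real (p ^ m choose (p ^ i))) | c :: nat \<Rightarrow> int.
             \<forall>i\<in>{1..m - 1}. 0 \<le> c i \<and> c i \<le> int p - 1}" (is ?apery)
    and "real_of_int (frobenius_number (binomial_semigroup (p ^ m))) =
          (real p - 1) / real p * (\<Sum>i=1..m - 1. real ((p ^ m) choose (p ^ i))) - real (p ^ (m - 1))" (is ?frobenius)
proof -
  define n where "n = p ^ m"
  define N where "N = p ^ (m - 1)"
  have n_eq: "n = p * N"
    using m by (cases m) (simp_all add: n_def N_def)
  \<comment> \<open>For \<open>0 < k < n\<close> the gcd of \<open>k\<close> and \<open>n\<close> is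
    a proper divisor of \<open>p ^ m\<close>, hence divides \<open>N\<close>. If \<open>p\<close>
    did not divide \<open>n choose k\<close>, then \<open>n\<close> would divide this gcd.\<close>
  interpret scaled_binomials n p N
  proof
    show "2 \<le> n"
      unfolding n_def using m p prime_ge_2_nat[OF p]
      by (metis One_nat_def Suc_le_eq le_trans self_le_power order_less_imp_le prime_gt_1_nat)
    show "p dvd n choose k" if "0 < k" "k < n" for k
    proof (rule ccontr)
      assume "\<not> p dvd n choose k"
      then have "coprime n (n choose k)"
        using p by (simp add: n_def prime_imp_coprime)
      then have "n dvd gcd k n"
        using dvd_gcd_mult_binomial[OF that(1), of n] by (simp only: coprime_dvd_mult_left_iff)
      then have "n dvd k" by simp
      with that show False by (auto dest: dvd_imp_le)
    qed
    show "gcd k n dvd N" if "0 < k" "k < n" for k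
    proof -
      obtain a where a: "a \<le> m" "gcd k n = p ^ a"
        using p by (metis divides_primepow_nat gcd_dvd2 n_def)
      have "a \<noteq> m"
        using a that by (metis gcd_dvd1 n_def nat_dvd_not_less)
      then show ?thesis
        using a by (simp add: N_def le_imp_power_dvd)
    qed
    show "2 * q \<le> n" if "q \<in> primepow_factors N" for q
    proof -
      have "q \<le> N"
        using that p by (auto simp: primepow_factors_def N_def prime_gt_0_nat intro: dvd_imp_le)
      then show ?thesis
        unfolding n_eq using prime_ge_2_nat[OF p] by (rule mult_le_mono[rotated])
    qed
  qed (rule n_eq)
  have "primepow n" "aprimedivisor n = p"
    using p m by (auto simp: n_def aprimedivisor_prime_power)
  then have S: "binomial_semigroup (p ^ m) = S"
    by (simp add: binomial_semigroup_def S_def b_def flip: n_def)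
  have bij: "bij_betw (\<lambda>i. p ^ i) {1..m - 1} (primepow_factors N)"
    unfolding N_def by (rule bij_betw_primepow_factors_power[OF p])
  have real_b: "real (b (p ^ i)) = real (p ^ m choose p ^ i) / real p" if "i \<in> {1..m - 1}" for i
  proof -
    have "p ^ i \<in> primepow_factors N"
      using bij that by (auto simp: bij_betw_def)
    then have "p * b (p ^ i) = p ^ m choose p ^ i"
      using d_mult_b[of "p ^ i"] primepow_factor_bounds[of "p ^ i"] by (simp add: n_def)
    then show ?thesis
      using p by (metis nonzero_mult_div_cancel_left of_nat_eq_0_iff of_nat_mult not_prime_0)
  qed
  have sum: "real_of_int (\<Sum>i=1..m - 1. f i * int (b (p ^ i))) =
      1 / real p * (\<Sum>i=1..m - 1. real_of_int (f i) * real (p ^ m choose (p ^ i)))" for f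
    unfolding sum_distrib_left of_int_sum using real_b by (intro sum.cong) auto
  have ap: "aprimedivisor (p ^ i) = p" if "i \<in> {1..m - 1}" for i
    using that p by (simp add: aprimedivisor_prime_power)
  have "real ` apery_set S N = real_of_int ` int ` apery_set S N"
    by (simp add: image_image)
  also have "\<dots> = {real_of_int (\<Sum>i=1..m - 1. f i * int (b (p ^ i))) | f.
      \<forall>i\<in>{1..m - 1}. 0 \<le> f i \<and> f i \<le> int p - 1}"
    unfolding apery_set_S_reindex[OF bij] using ap by (simp add: setcompr_eq_image image_image)
  finally show ?apery
    unfolding sum S N_def .
  have "frobenius_number S = (\<Sum>i=1..m - 1. (int p - 1) * int (b (p ^ i))) - int N"
    unfolding frobenius_number_S_reindex[OF bij] using ap by simp
  then have "real_of_int (frobenius_number S) =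
      1 / real p * (\<Sum>i=1..m - 1. real_of_int (int p - 1) * real (p ^ m choose (p ^ i))) - real N"
    unfolding sum[symmetric] by simp
  then show ?frobenius
    unfolding S N_def by (simp add: sum_distrib_left)
qed

theorem theorem0p1:
  shows
  "(\<forall>(n::nat) (t::nat) (p::nat \<Rightarrow> nat) (k::nat \<Rightarrow> nat).
      t \<ge> 2 \<and> (\<forall>i\<in>{1..t}. prime (p i)) \<and> strict_mono_on {1..t} p \<and>
      (\<forall>i\<in>{1..t}. k i \<ge> 1) \<and> n = (\<Prod>i=1..t. p i ^ k i) \<longrightarrow>
        int ` apery_set (binomial_semigroup n) n =
          {\<Sum>i=1..t. \<Sum>j=1..k i. c i j * int (n choose (p i ^ j)) | c :: nat \<Rightarrow> nat \<Rightarrow> int.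
             \<forall>i\<in>{1..t}. \<forall>j\<in>{1..k i}. 0 \<le> c i j \<and> c i j \<le> int (p i) - 1} \<and>
        frobenius_number (binomial_semigroup n) =
          (\<Sum>i=1..t. \<Sum>j=1..k i. (int (p i) - 1) * int (n choose (p i ^ j))) - int n) \<and>
   (\<forall>(n::nat) (p::nat) (m::nat).
      prime p \<and> m \<ge> 1 \<and> n = p ^ m \<longrightarrow>
        real ` apery_set (binomial_semigroup n) (p ^ (m - 1)) =
          {1 / real p * (\<Sum>i=1..m - 1. real_of_int (c i) * real (n choose (p ^ i))) | c :: nat \<Rightarrow> int.
             \<forall>i\<in>{1..m - 1}. 0 \<le> c i \<and> c i \<le> int p - 1} \<and>
        real_of_int (frobenius_number (binomial_semigroup n)) =
          (real p - 1) / real p * (\<Sum>i=1..m - 1. real ((p ^ m) choose (p ^ i))) - real (p ^ (m - 1)))"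
proof (intro conjI allI impI; elim conjE)
qed ((rule binomial_semigroup_not_primepow; assumption) | (simp only: binomial_semigroup_prime_power))+

end
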